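(* Let $\Lambda_1$ and $\Lambda_2$ be two instances of the robust remanufacturing planning model, with ambiguity sets $\mathcal{U}^1_{sk}$ and $\mathcal{U}^2_{sk}$ constructed using the Kullback–Leibler distance or the interval matrix model, such that: (1) the reward functions are the same; (2) $\mathcal{U}^1_{sk}\subseteq\mathcal{U}^2_{sk}$ for all $(s,k)\in\mathcal{S}\times\mathcal{K}$; (3) the conditions ensuring the control-limit structure of the optimal robust policies (listed in the context) are satisfied by both instances. With $k_i^\ast$, $\zeta^i_{\rm rm}$, $\zeta^i_{\rm scrap}$ denoting the threshold and the control limits of the optimal robust policy of $\Lambda_i$ ($i=1,2$), the following holds: (a) for $k<k_1^\ast$, $\zeta^1_{\rm rm}(k)\le\zeta^2_{\rm rm}(k)$ if $p_1^\ast(\tilde s|\tilde s,k)=0$, where $\tilde s=\zeta^1_{\rm rm}(k)-1$; (b) for $k\ge k_1^\ast$, $\zeta^1_{\rm scrap}(k)\ge\zeta^2_{\rm scrap}(k)$; (c) $k_1^\ast\ge k_2^\ast$.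
   Context: Model. $\mathcal{S}=\{0,1,\dots,S\}$ is the set of conditions of a component (larger is worse), $\mathcal{K}=\{0,1,2,\dots\}$ is the set of cumulative numbers of completed remanufacturing activities, and $\mathcal{A}=\{0,1,2\}$ is the set of actions ($0$: continue operation, $1$: remanufacture, $2$: scrap). The one-period reward of operating is $r(s,k)=g(s,k)-e(s,k)$, where $g$ is the operational gain and $e$ the environmental (carbon) cost; $c_{\rm r}$ is the remanufacturing cost, $c_{\rm s}$ the salvage value, $\beta\in(0,1)$ the discount factor. The two instances share $\mathcal{S},\mathcal{K},g,e,c_{\rm r},c_{\rm s},\beta$ and differ only in the ambiguity sets. Under action $0$ the component at $(s,k)$ moves to $(s',k)$ with probability $p(s'|s,k)$; deterioration is irreversible ($p(s'|s,k)=0$ for $s'<s$), and $S$ is absorbing under action $0$. The row $\pmb p(\cdot|s,k)$ is only known to lie in an ambiguity set $\mathcal{U}_{sk}$ of probability vectors on $\mathcal{S}$, and the overall ambiguity set is the product $\bigotimes_{s,k}\mathcal{U}_{sk}$ (rectangularity). The value function $V$ satisfies $$V(s,k)=\max_{a\in\mathcal{A}}w(s,k;a),$$ $$w(s,k;0)=\inf_{\pmb p(\cdot|s,k)\in\mathcal{U}_{sk}}\Big\{r(s,k)+\beta\sum_{s'\in\mathcal{S}}p(s'|s,k)V(s',k)\Big\},\quad w(s,k;1)=-c_{\rm r}+\beta V(0,k+1),\quad w(s,k;2)=c_{\rm s},$$ and is the limit of robust value iteration (iterating the right-hand side starting from the zero function). The optimal robust policy is $a(s,k)\in\arg\max_{a\in\mathcal{A}}w(s,k;a)$.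 $\pmb p_i^\ast(\cdot|s,k)$ denotes the worst-case distribution of $\Lambda_i$, i.e. the element of $\mathcal{U}^i_{sk}$ attaining the infimum in $w_i(s,k;0)$, where $w_i$ is the function $w$ for $\Lambda_i$. KL-distance ambiguity set: $\mathcal{U}_{sk}=\{\pmb p: D(\pmb p\|\hat{\pmb p}(\cdot|s,k))\le\theta\}$, where $\hat{\pmb p}(\cdot|s,k)$ is a nominal transition distribution (subject to the same irreversibility and absorption), $\hat{\pmb P}(\cdot|\cdot,k)=[\hat p(s'|s,k)]$, $D(\pmb p\|\hat{\pmb p})=\sum_{s'}p(s')\log\frac{p(s')}{\hat p(s')}$ (with $0\log0=0$, $D=\infty$ if $p(s')>0=\hat p(s')$ for some $s'$), and $\theta>0$. Interval matrix ambiguity set: $\mathcal{U}_{sk}=\{\pmb p(\cdot|s,k):\underline p(s'|s,k)\le p(s'|s,k)\le\bar p(s'|s,k)\ \forall s',\ \sum_{s'}p(s'|s,k)=1\}$, nonempty, with rows respecting irreversibility and absorption; $\bar p,\underline p$ denote effective bounds, i.e. the given bounds replaced by $\min\{\bar p(s'|s,k),1-\sum_{s''\ne s'}\underline p(s''|s,k)\}$ and $\max\{\underline p(s'|s,k),1-\sum_{s''\ne s'}\bar p(s''|s,k)\}$ respectively. Stochastic orders. A transition matrix $[p(i|j)]_{i,j=0,\dots,n}$ ($j$ current state, $i$ next state) is IFR if $\sum_{i=m}^np(i|j)$ is non-decreasing in $j$ for every $m$; $\pmb P_1\succeq\pmb P_2$ means $\sum_{i=m}^np_1(i|j)\ge\sum_{i=m}^np_2(i|j)$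 for all $j,m$. Conditions ensuring control-limit structure. In both cases: $g(s,k)$ is non-increasing in $s$ and in $k$, $e(s,k)$ is non-decreasing in $s$ and in $k$, and $\frac{r(S,0)}{1-\beta}<c_{\rm s}$. For a KL instance: for all $k$, $\hat{\pmb P}(\cdot|\cdot,k)$ is IFR and $\hat{\pmb P}(\cdot|\cdot,k+1)\succeq\hat{\pmb P}(\cdot|\cdot,k)$. For an interval matrix instance: for all $i\in\mathcal{S}$, $\sum_{s''=0}^{i}\underline p(s''|s,k)\ge\sum_{s''=0}^{i}\underline p(s''|s',k)$ and $\sum_{s''=i}^{S}\bar p(s''|s,k)\le\sum_{s''=i}^{S}\bar p(s''|s',k)$ whenever $s'\ge s$, $k\in\mathcal{K}$; and $\sum_{s''=0}^{i}\underline p(s''|s,k)\ge\sum_{s''=0}^{i}\underline p(s''|s,k')$ and $\sum_{s''=i}^{S}\bar p(s''|s,k)\le\sum_{s''=i}^{S}\bar p(s''|s,k')$ whenever $k'\ge k$, $s\in\mathcal{S}$. Control limits. The optimal robust policy has the following form: there are $k^\ast\in\mathcal{K}$ and $s_k\in\mathcal{S}$ ($k\in\mathcal{K}$) such that $a(s,k)=0$ for $s<s_k$; and for $s\ge s_k$, $a(s,k)=1$ if $k<k^\ast$ and $a(s,k)=2$ if $k\ge k^\ast$. One writes $\zeta_{\rm rm}(k)=s_k$ for $k<k^\ast$ and $\zeta_{\rm scrap}(k)=s_k$ for $k\ge k^\ast$; a subscript or superscript $i$ refers to $\Lambda_i$.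
   Formalization: When several actions attain the maximum, the optimal robust policies of both instances are required to break ties by the same fixed strict preference order of the actions; with arbitrary choices from the argmax, (c) can fail even for equal ambiguity sets. *)

theory Defs
  imports "HOL-Analysis.Analysis"
begin

datatype action = Continue | Remanufacture | Scrap

record model =
  worst :: nat  \<comment> \<open>the index of the worst condition: the conditions are \<open>{..worst M}\<close>\<close>
  gain :: "nat \<Rightarrow> nat \<Rightarrow> real"
  env_cost :: "nat \<Rightarrow> nat \<Rightarrow> real"
  reman_cost :: real
  salvage :: real
  discount :: real

definition reward :: "model \<Rightarrow> nat \<Rightarrow> nat \<Rightarrow> real" where
  "reward M s k = gain M s k - env_cost M s k"

text \<open>Functions of a condition \<open>s\<close> and a remanufacturing count \<open>k\<close> take their arguments
  in this order. A family \<open>p\<close> of transition rows is applied as \<open>p s k s'\<close> for $p(s'|s,k)$.\<close>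

type_synonym rows = "nat \<Rightarrow> nat \<Rightarrow> nat \<Rightarrow> real"
type_synonym ambiguity = "nat \<Rightarrow> nat \<Rightarrow> (nat \<Rightarrow> real) set"

definition prob_vectors :: "nat \<Rightarrow> (nat \<Rightarrow> real) set" where
  "prob_vectors n = {p. (\<forall>i\<le>n. 0 \<le> p i) \<and> (\<forall>i>n. p i = 0) \<and> (\<Sum>i\<le>n. p i) = 1}"

text \<open>The row \<open>p\<close> of condition \<open>s\<close> is irreversible, and absorbing if \<open>s\<close> is the worst condition.\<close>

definition deteriorating :: "nat \<Rightarrow> nat \<Rightarrow> (nat \<Rightarrow> real) \<Rightarrow> bool" where
  "deteriorating n s p \<longleftrightarrow> (\<forall>s'<s. p s' = 0) \<and> (s = n \<longrightarrow> p n = 1)"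

definition continuation :: "model \<Rightarrow> (nat \<Rightarrow> nat \<Rightarrow> real) \<Rightarrow> nat \<Rightarrow> nat \<Rightarrow> (nat \<Rightarrow> real) \<Rightarrow> real" where
  "continuation M V s k p = reward M s k + discount M * (\<Sum>s'\<le>worst M. p s' * V s' k)"

fun action_value ::
    "model \<Rightarrow> ambiguity \<Rightarrow> (nat \<Rightarrow> nat \<Rightarrow> real) \<Rightarrow> nat \<Rightarrow> nat \<Rightarrow> action \<Rightarrow> real" where
  "action_value M U V s k Continue = (INF p\<in>U s k. continuation M V s k p)"
| "action_value M U V s k Remanufacture = - reman_cost M + discount M * V 0 (k + 1)"
| "action_value M U V s k Scrap = salvage M"

definition bellman ::
    "model \<Rightarrow> ambiguity \<Rightarrow> (nat \<Rightarrow> nat \<Rightarrow> real) \<Rightarrow> nat \<Rightarrow> nat \<Rightarrow> real" where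
  "bellman M U V s k = Max (range (action_value M U V s k))"

definition value_fun :: "model \<Rightarrow> ambiguity \<Rightarrow> nat \<Rightarrow> nat \<Rightarrow> real" where
  "value_fun M U s k = lim (\<lambda>n. (bellman M U ^^ n) (\<lambda>_ _. 0) s k)"

definition optimal_action :: "model \<Rightarrow> ambiguity \<Rightarrow> nat \<Rightarrow> nat \<Rightarrow> action \<Rightarrow> bool" where
  "optimal_action M U s k a \<longleftrightarrow>
     is_arg_max (action_value M U (value_fun M U) s k) (\<lambda>_. True) a"

text \<open>A maximising action need not be unique, and the comparison of two instances fails if
  they may break ties in different ways. Ties are therefore broken by a ranking \<open>rk\<close> of the
  actions (lowest rank first), which is to be injective and the same for both instances.\<close>

definition optimal_policy ::
    "model \<Rightarrow> ambiguity \<Rightarrow> (action \<Rightarrow> nat) \<Rightarrow> (nat \<Rightarrow> nat \<Rightarrow> action) \<Rightarrow> bool" where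
  "optimal_policy M U rk a \<longleftrightarrow>
     (\<forall>s\<le>worst M. \<forall>k. is_arg_min rk (optimal_action M U s k) (a s k))"

definition worst_case :: "model \<Rightarrow> ambiguity \<Rightarrow> nat \<Rightarrow> nat \<Rightarrow> (nat \<Rightarrow> real) \<Rightarrow> bool" where
  "worst_case M U s k p \<longleftrightarrow>
     is_arg_min (continuation M (value_fun M U) s k) (\<lambda>q. q \<in> U s k) p"

text \<open>The limit \<open>\<zeta> k\<close> is the control limit for remanufacturing if \<open>k < kstar\<close>, and the one
  for scrapping if \<open>kstar \<le> k\<close>.\<close>

definition control_limits ::
    "model \<Rightarrow> (nat \<Rightarrow> nat \<Rightarrow> action) \<Rightarrow> nat \<Rightarrow> (nat \<Rightarrow> nat) \<Rightarrow> bool" where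
  "control_limits M a kstar \<zeta> \<longleftrightarrow>
     (\<forall>k. \<zeta> k \<le> worst M \<and>
        (\<forall>s\<le>worst M. a s k = (if s < \<zeta> k then Continue
                               else if k < kstar then Remanufacture else Scrap)))"

text \<open>In HOL \<open>ln 0 = 0\<close> and \<open>x / 0 = 0\<close>, so terms with \<open>p i = 0\<close> vanish as they should.\<close>

definition KL_dist :: "nat \<Rightarrow> (nat \<Rightarrow> real) \<Rightarrow> (nat \<Rightarrow> real) \<Rightarrow> ereal" where
  "KL_dist n p q =
     (if \<exists>i\<le>n. p i > 0 \<and> q i = 0 then \<infinity> else ereal (\<Sum>i\<le>n. p i * ln (p i / q i)))"

definition KL_ambiguity :: "model \<Rightarrow> rows \<Rightarrow> real \<Rightarrow> ambiguity" where
  "KL_ambiguity M phat \<theta> s k =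
     {p \<in> prob_vectors (worst M). KL_dist (worst M) p (phat s k) \<le> ereal \<theta>}"

text \<open>Transition matrices are applied as \<open>P j i\<close> with \<open>j\<close> the current and \<open>i\<close> the next state.\<close>

definition IFR :: "nat \<Rightarrow> (nat \<Rightarrow> nat \<Rightarrow> real) \<Rightarrow> bool" where
  "IFR n P \<longleftrightarrow> (\<forall>m\<le>n. mono_on {..n} (\<lambda>j. \<Sum>i=m..n. P j i))"

definition stoch_dominates ::
    "nat \<Rightarrow> (nat \<Rightarrow> nat \<Rightarrow> real) \<Rightarrow> (nat \<Rightarrow> nat \<Rightarrow> real) \<Rightarrow> bool" where
  "stoch_dominates n P Q \<longleftrightarrow> (\<forall>j\<le>n. \<forall>m\<le>n. (\<Sum>i=m..n. P j i) \<ge> (\<Sum>i=m..n. Q j i))"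

definition KL_instance :: "model \<Rightarrow> ambiguity \<Rightarrow> bool" where
  "KL_instance M U \<longleftrightarrow>
     (\<exists>phat \<theta>. 0 < \<theta>
       \<and> (\<forall>s\<le>worst M. \<forall>k. phat s k \<in> prob_vectors (worst M)
                         \<and> deteriorating (worst M) s (phat s k)
                         \<and> U s k = KL_ambiguity M phat \<theta> s k)
       \<and> (\<forall>k. IFR (worst M) (\<lambda>s. phat s k))
       \<and> (\<forall>k. stoch_dominates (worst M) (\<lambda>s. phat s (k + 1)) (\<lambda>s. phat s k)))"

text \<open>The ambiguity set and the monotonicity conditions below use the effective bounds; the set
  itself is the same for the given bounds.\<close>

definition eff_upper :: "nat \<Rightarrow> rows \<Rightarrow> rows \<Rightarrow> rows" where
  "eff_upper n lo up s k s' = min (up s k s') (1 - (\<Sum>i\<in>{..n} - {s'}. lo s k i))"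

definition eff_lower :: "nat \<Rightarrow> rows \<Rightarrow> rows \<Rightarrow> rows" where
  "eff_lower n lo up s k s' = max (lo s k s') (1 - (\<Sum>i\<in>{..n} - {s'}. up s k i))"

definition interval_ambiguity :: "model \<Rightarrow> rows \<Rightarrow> rows \<Rightarrow> ambiguity" where
  "interval_ambiguity M lo up s k =
     {p \<in> prob_vectors (worst M). \<forall>s'\<le>worst M. lo s k s' \<le> p s' \<and> p s' \<le> up s k s'}"

text \<open>Row \<open>(s', k')\<close> of the bounds is at least as deteriorated as row \<open>(s, k)\<close>.\<close>

definition bounds_ordered :: "nat \<Rightarrow> rows \<Rightarrow> rows \<Rightarrow> nat \<Rightarrow> nat \<Rightarrow> nat \<Rightarrow> nat \<Rightarrow> bool" where
  "bounds_ordered n lo up s k s' k' \<longleftrightarrow>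
     (\<forall>i\<le>n. (\<Sum>j=0..i. lo s k j) \<ge> (\<Sum>j=0..i. lo s' k' j)
           \<and> (\<Sum>j=i..n. up s k j) \<le> (\<Sum>j=i..n. up s' k' j))"

definition interval_instance :: "model \<Rightarrow> ambiguity \<Rightarrow> bool" where
  "interval_instance M U \<longleftrightarrow>
     (\<exists>lo0 up0 lo up. lo = eff_lower (worst M) lo0 up0 \<and> up = eff_upper (worst M) lo0 up0
       \<and> (\<forall>s\<le>worst M. \<forall>k. U s k = interval_ambiguity M lo up s k \<and> U s k \<noteq> {}
                         \<and> (\<forall>p\<in>U s k. deteriorating (worst M) s p))
       \<and> (\<forall>s s' k. s \<le> s' \<and> s' \<le> worst M \<longrightarrow> bounds_ordered (worst M) lo up s k s' k)
       \<and> (\<forall>s k k'. s \<le> worst M \<and> k \<le> k' \<longrightarrow> bounds_ordered (worst M) lo up s k s k'))"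

definition common_conditions :: "model \<Rightarrow> bool" where
  "common_conditions M \<longleftrightarrow>
     (\<forall>k. antimono_on {..worst M} (\<lambda>s. gain M s k)) \<and>
     (\<forall>s\<le>worst M. antimono (gain M s)) \<and>
     (\<forall>k. mono_on {..worst M} (\<lambda>s. env_cost M s k)) \<and>
     (\<forall>s\<le>worst M. mono (env_cost M s)) \<and>
     reward M (worst M) 0 / (1 - discount M) < salvage M"

end

theory Submission
  imports Defs
begin

text \<open>Bellman operators are monotone contractions, so robust value iteration converges to a fixed
  point, and enlarging the ambiguity sets can only lower the value function and the value of each
  action. Scrapping pays the same in both instances; hence it is chosen in the second instance
  whenever it is in the first, which gives (b) and (c).
  For (a), let \<open>T\<close> be the better of the values of remanufacturing and of scrapping, which does not
  depend on the condition; then \<open>T\<^sub>2 \<le> T\<^sub>1\<close>. The assumption on the worst-case row sends the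
  component from \<open>s\<close>, the last condition in which the first instance continues, directly into the
  region where the value is \<open>T\<^sub>1\<close>. So continuing at \<open>s\<close> is worth at most \<open>r + \<beta> T\<^sub>1\<close>, whence
  \<open>r \<ge> (1 - \<beta>) T\<^sub>1\<close>. In the second instance it is worth at least \<open>r + \<beta> T\<^sub>2 \<ge> T\<^sub>2\<close>, and a tie with
  another action there forces \<open>T\<^sub>1 = T\<^sub>2\<close> and the same tie in the first instance.\<close>

section \<open>The Bellman operator\<close>

lemma finite_range_action: "finite (range (f :: action \<Rightarrow> 'a))"
proof (rule finite_subset)
  show "range f \<subseteq> {f Continue, f Remanufacture, f Scrap}"
    by (auto, metis action.exhaust)
qed simp

lemma action_value_le_bellman: "action_value M U V s k a \<le> bellman M U V s k"
  unfolding bellman_def by (simp add: finite_range_action)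

lemma bellman_attained: "\<exists>a. bellman M U V s k = action_value M U V s k a"
proof -
  have "bellman M U V s k \<in> range (action_value M U V s k)"
    unfolding bellman_def by (rule Max_in) (auto simp: finite_range_action)
  then show ?thesis by blast
qed

text \<open>The comparison is asked for only where \<open>p\<close> has mass, so that a row avoiding
  a condition can be bounded without knowing the value there.\<close>

lemma prob_vectors_expectation_mono:
  assumes "p \<in> prob_vectors n" and "\<And>i. i \<le> n \<Longrightarrow> p i \<noteq> 0 \<Longrightarrow> f i \<le> g i"
  shows "(\<Sum>i\<le>n. p i * f i) \<le> (\<Sum>i\<le>n. p i * (g i :: real))"
proof (rule sum_mono)
  fix i assume "i \<in> {..n}"
  then show "p i * f i \<le> p i * g i"
    using assms by (cases "p i = 0") (auto simp: prob_vectors_def intro!: mult_left_mono)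
qed

lemma prob_vectors_expectation_const:
  assumes "p \<in> prob_vectors n"
  shows "(\<Sum>i\<le>n. p i * c) = (c::real)"
  using assms by (simp add: prob_vectors_def flip: sum_distrib_right)

text \<open>The weights sum to one, so a constant slack \<open>d\<close> passes through the
  expectation and is only discounted. It may have either sign.\<close>

lemma continuation_mono:
  assumes "0 \<le> discount M" and "p \<in> prob_vectors (worst M)"
    and "\<And>s'. s' \<le> worst M \<Longrightarrow> p s' \<noteq> 0 \<Longrightarrow> V s' k \<le> W s' k + d"
  shows "continuation M V s k p \<le> continuation M W s k p + discount M * d"
proof -
  have "(\<Sum>i\<le>worst M. p i * V i k) \<le> (\<Sum>i\<le>worst M. p i * (W i k + d))"
    using assms(2,3) by (rule prob_vectors_expectation_mono)
  also have "\<dots> = (\<Sum>i\<le>worst M. p i * W i k) + d"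
    using prob_vectors_expectation_const[OF assms(2)] by (simp add: distrib_left sum.distrib)
  finally show ?thesis
    using mult_left_mono[OF _ assms(1)] by (fastforce simp: continuation_def distrib_left)
qed

lemma continuation_le:
  assumes "0 \<le> discount M" and "p \<in> prob_vectors (worst M)"
    and "\<And>s'. s' \<le> worst M \<Longrightarrow> p s' \<noteq> 0 \<Longrightarrow> V s' k \<le> c"
  shows "continuation M V s k p \<le> reward M s k + discount M * c"
  using continuation_mono[OF assms(1,2), of V k "\<lambda>_ _. 0" c s] assms(3)
  by (simp add: continuation_def)

lemma continuation_ge:
  assumes "0 \<le> discount M" and "p \<in> prob_vectors (worst M)"
    and "\<And>s'. s' \<le> worst M \<Longrightarrow> c \<le> V s' k"
  shows "reward M s k + discount M * c \<le> continuation M V s k p"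
  using continuation_mono[OF assms(1,2), of "\<lambda>_ _. 0" k V "- c" s] assms(3)
  by (simp add: continuation_def)

text \<open>A real infimum lies below its members only if the set is bounded below; the least of the
  finitely many values of \<open>V\<close> at \<open>k\<close> gives a bound.\<close>

lemma bdd_below_continuation:
  assumes "0 \<le> discount M" and "P \<subseteq> prob_vectors (worst M)"
  shows "bdd_below (continuation M V s k ` P)"
proof (rule bdd_belowI2)
  fix p assume "p \<in> P"
  then have "p \<in> prob_vectors (worst M)"
    using assms(2) by blast
  then show "reward M s k + discount M * Min ((\<lambda>s'. V s' k) ` {..worst M}) \<le> continuation M V s k p"
    using assms(1) by (intro continuation_ge) auto
qed

text \<open>Serves two purposes: \<open>d = 0\<close> compares the two instances, and
  \<open>U1 = U2\<close> with \<open>d\<close> a uniform distance gives the contraction.\<close>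

lemma action_value_mono:
  assumes "0 \<le> discount M" and "0 \<le> d"
    and "U1 s k \<subseteq> U2 s k" and "U1 s k \<noteq> {}" and "U2 s k \<subseteq> prob_vectors (worst M)"
    and le: "\<And>s' k'. s' \<le> worst M \<Longrightarrow> V s' k' \<le> W s' k' + d"
  shows "action_value M U2 V s k a \<le> action_value M U1 W s k a + discount M * d"
proof (cases a)
  case Continue
  have "(INF p\<in>U2 s k. continuation M V s k p) - discount M * d \<le> (INF p\<in>U1 s k. continuation M W s k p)"
  proof (rule cINF_greatest)
    fix p assume "p \<in> U1 s k"
    then have p: "p \<in> U2 s k"
      using assms(3) by blast
    then have "(INF p\<in>U2 s k. continuation M V s k p) \<le> continuation M V s k p"
      by (intro cINF_lower bdd_below_continuation assms)
    also have "\<dots> \<le> continuation M W s k p + discount M * d"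
      using assms(5) p by (intro continuation_mono assms(1) le) auto
    finally show "(INF p\<in>U2 s k. continuation M V s k p) - discount M * d \<le> continuation M W s k p"
      by simp
  qed fact
  then show ?thesis
    using Continue by simp
next
  case Remanufacture
  then show ?thesis
    using mult_left_mono[OF le[of 0 "k + 1"] assms(1)] by (simp add: distrib_left)
qed (use assms(1,2) in simp)

lemma bellman_mono:
  assumes "0 \<le> discount M" and "0 \<le> d"
    and "U1 s k \<subseteq> U2 s k" and "U1 s k \<noteq> {}" and "U2 s k \<subseteq> prob_vectors (worst M)"
    and "\<And>s' k'. s' \<le> worst M \<Longrightarrow> V s' k' \<le> W s' k' + d"
  shows "bellman M U2 V s k \<le> bellman M U1 W s k + discount M * d"
proof -
  obtain a where "bellman M U2 V s k = action_value M U2 V s k a"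
    using bellman_attained by blast
  also have "\<dots> \<le> action_value M U1 W s k a + discount M * d"
    using assms by (rule action_value_mono)
  finally show ?thesis
    using action_value_le_bellman[of M U1 W s k a] by simp
qed

section \<open>Convergence of robust value iteration\<close>

text \<open>\<open>B\<close> bounds the rewards from above only, as they may fall without bound when
  \<open>k\<close> grows. The option of scrapping bounds the iterates from below.\<close>

locale robust_model =
  fixes M :: model and U :: ambiguity and B :: real
  assumes discount: "0 < discount M" "discount M < 1"
    and nonempty: "s \<le> worst M \<Longrightarrow> U s k \<noteq> {}"
    and prob: "s \<le> worst M \<Longrightarrow> U s k \<subseteq> prob_vectors (worst M)"
    and reward_le: "s \<le> worst M \<Longrightarrow> reward M s k \<le> B"
begin

abbreviation iterate :: "nat \<Rightarrow> nat \<Rightarrow> nat \<Rightarrow> real" where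
  "iterate n \<equiv> (bellman M U ^^ n) (\<lambda>_ _. 0)"

lemma bellman_contraction:
  assumes "s \<le> worst M" and "\<And>s k. s \<le> worst M \<Longrightarrow> \<bar>V s k - W s k\<bar> \<le> d"
  shows "\<bar>bellman M U V s k - bellman M U W s k\<bar> \<le> discount M * d"
proof -
  have "0 \<le> d"
    using assms(2)[OF assms(1)] by (rule order_trans[OF abs_ge_zero])
  moreover have "V s' k' \<le> W s' k' + d" "W s' k' \<le> V s' k' + d" if "s' \<le> worst M" for s' k'
    using assms(2)[OF that, of k'] by auto
  ultimately show ?thesis
    using bellman_mono[of M d U s k U V W] bellman_mono[of M d U s k U W V]
      discount nonempty prob assms(1) by force
qed

lemma bellman_le:
  assumes "s \<le> worst M" and "\<And>s k. s \<le> worst M \<Longrightarrow> V s k \<le> H"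
    and "salvage M \<le> H" and "B \<le> (1 - discount M) * H" and "- reman_cost M \<le> (1 - discount M) * H"
  shows "bellman M U V s k \<le> H"
proof -
  obtain a where a: "bellman M U V s k = action_value M U V s k a"
    using bellman_attained by blast
  have "action_value M U V s k a \<le> H"
  proof (cases a)
    case Continue
    obtain p where p: "p \<in> U s k"
      using nonempty[OF assms(1)] by blast
    then have "(INF p\<in>U s k. continuation M V s k p) \<le> continuation M V s k p"
      using discount prob[OF assms(1)] by (intro cINF_lower bdd_below_continuation) auto
    also have "\<dots> \<le> reward M s k + discount M * H"
      using discount prob[OF assms(1)] p assms(2) by (intro continuation_le) auto
    also have "\<dots> \<le> H"
      using reward_le[OF assms(1), of k] assms(4) by (simp add: algebra_simps)
    finally show ?thesis
      using Continue by simp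
  next
    case Remanufacture
    have "discount M * V 0 (k + 1) \<le> discount M * H"
      using discount assms(2) by (intro mult_left_mono) auto
    then show ?thesis
      using Remanufacture assms(5) by (simp add: algebra_simps)
  qed (use assms(3) in simp)
  then show ?thesis
    using a by simp
qed

lemma iterate_bounded:
  obtains C where "\<And>n s k. s \<le> worst M \<Longrightarrow> \<bar>iterate n s k\<bar> \<le> C"
proof -
  \<comment> \<open>The least constant satisfying the side conditions of \<open>bellman_le\<close>
    that also bounds the zero function from which the iteration starts.\<close>
  define H where "H = max 0 (max (salvage M) (max (B / (1 - discount M)) ((- reman_cost M) / (1 - discount M))))"
  have H: "0 \<le> H" "salvage M \<le> H" "B / (1 - discount M) \<le> H" "(- reman_cost M) / (1 - discount M) \<le> H"
    unfolding H_def by (simp_all only: le_max_iff_disj order_refl simp_thms)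
  then have H': "B \<le> (1 - discount M) * H" "- reman_cost M \<le> (1 - discount M) * H"
    using H(3,4)[THEN mult_left_mono, of "1 - discount M"] discount by simp_all
  have upper: "iterate n s k \<le> H" if "s \<le> worst M" for n s k
    using that
  proof (induction n arbitrary: s k)
    case 0
    then show ?case using H(1) by simp
  next
    case (Suc n)
    then show ?case using bellman_le[OF Suc.prems, of "iterate n"] H(2) H' by simp
  qed
  \<comment> \<open>Scrapping is available at every step; the \<open>0\<close> covers the starting
    function.\<close>
  have lower: "min 0 (salvage M) \<le> iterate n s k" for n s k
  proof (cases n)
    case (Suc m)
    then show ?thesis
      using action_value_le_bellman[of M U "iterate m" s k Scrap] by simp
  qed simp
  show ?thesis
  proof (rule that)
    fix n s k assume "s \<le> worst M"
    then show "\<bar>iterate n s k\<bar> \<le> H - min 0 (salvage M)"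
      using upper[of s n k] lower[of n s k] H(1) by (auto simp: min_def split: if_splits)
  qed
qed

text \<open>Iterate \<open>m\<close> is within \<open>C\<close> of the zero function, and each
  further step shrinks the gap by the discount factor. \<open>C\<close> does not depend on
  \<open>k\<close>, although \<open>k\<close> is unbounded.\<close>

lemma iterate_cauchy:
  obtains C where "\<And>m n s k. s \<le> worst M \<Longrightarrow> \<bar>iterate (m + n) s k - iterate n s k\<bar> \<le> discount M ^ n * C"
proof -
  obtain C where C: "\<And>n s k. s \<le> worst M \<Longrightarrow> \<bar>iterate n s k\<bar> \<le> C"
    using iterate_bounded by blast
  have "\<bar>iterate (m + n) s k - iterate n s k\<bar> \<le> discount M ^ n * C" if "s \<le> worst M" for m n s k
    using that
  proof (induction n arbitrary: s k)
    case 0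
    then show ?case using C[OF 0, of m] by simp
  next
    case (Suc n)
    then show ?case
      using bellman_contraction[OF Suc.prems Suc.IH] by (simp add: mult.assoc)
  qed
  then show ?thesis
    using that by blast
qed

lemma iterate_tendsto_value_fun:
  assumes "s \<le> worst M"
  shows "(\<lambda>n. iterate n s k) \<longlonglongrightarrow> value_fun M U s k"
proof -
  obtain C where C: "\<And>m n s k. s \<le> worst M \<Longrightarrow> \<bar>iterate (m + n) s k - iterate n s k\<bar> \<le> discount M ^ n * C"
    using iterate_cauchy by blast
  have "(\<lambda>n. discount M ^ n * C) \<longlonglongrightarrow> 0 * C"
    using discount by (intro tendsto_mult_right LIMSEQ_power_zero) auto
  have "Cauchy (\<lambda>n. iterate n s k)"
  proof (rule metric_CauchyI)
    fix e :: real assume "0 < e"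
    then have "\<forall>\<^sub>F n in sequentially. discount M ^ n * C < e / 2"
      using \<open>_ \<longlonglongrightarrow> 0 * C\<close> by (intro order_tendstoD) auto
    then obtain N where N: "discount M ^ N * C < e / 2"
      by (auto simp: eventually_sequentially)
    have "\<bar>iterate n s k - iterate N s k\<bar> < e / 2" if "N \<le> n" for n
      using C[OF assms, of "n - N" N k] N that by simp
    then have "dist (iterate m s k) (iterate n s k) < e" if "N \<le> m" "N \<le> n" for m n
      using that unfolding dist_real_def by (smt (verit) field_sum_of_halves)
    then show "\<exists>N. \<forall>m\<ge>N. \<forall>n\<ge>N. dist (iterate m s k) (iterate n s k) < e"
      by blast
  qed
  then show ?thesis
    unfolding value_fun_def by (simp add: Cauchy_convergent_iff convergent_LIMSEQ_iff)
qed

text \<open>The geometric error bound survives the limit in \<open>m\<close>. It is uniform in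
  condition and count, so one more Bellman step contracts it, and the shifted iterates converge to
  both sides.\<close>

lemma bellman_value_fun:
  assumes "s \<le> worst M"
  shows "bellman M U (value_fun M U) s k = value_fun M U s k"
proof -
  obtain C where C: "\<And>m n s k. s \<le> worst M \<Longrightarrow> \<bar>iterate (m + n) s k - iterate n s k\<bar> \<le> discount M ^ n * C"
    using iterate_cauchy by blast
  have error: "\<bar>value_fun M U s k - iterate n s k\<bar> \<le> discount M ^ n * C" if "s \<le> worst M" for n s k
  proof (rule LIMSEQ_le_const2)
    show "(\<lambda>m. \<bar>iterate (m + n) s k - iterate n s k\<bar>) \<longlonglongrightarrow> \<bar>value_fun M U s k - iterate n s k\<bar>"
      using LIMSEQ_ignore_initial_segment[OF iterate_tendsto_value_fun[OF that], of n k]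
      by (intro tendsto_intros)
  qed (use C[OF that] in blast)
  have "(\<lambda>n. iterate (Suc n) s k) \<longlonglongrightarrow> bellman M U (value_fun M U) s k"
  proof (rule Lim_transform_bound[of "\<lambda>n. iterate (Suc n) s k - bellman M U (value_fun M U) s k"
        "\<lambda>n. discount M ^ Suc n * C", THEN Lim_null[THEN iffD2]])
    have "\<bar>bellman M U (value_fun M U) s k - bellman M U (iterate n) s k\<bar>
      \<le> discount M * (discount M ^ n * C)" for n
      using assms error by (rule bellman_contraction)
    then show "\<forall>\<^sub>F n in sequentially. norm (iterate (Suc n) s k - bellman M U (value_fun M U) s k)
      \<le> norm (discount M ^ Suc n * C)"
      by (intro always_eventually allI)
        (auto simp: abs_minus_commute mult.assoc intro: order_trans[OF _ abs_ge_self])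
    show "(\<lambda>n. discount M ^ Suc n * C) \<longlonglongrightarrow> 0"
      using discount
      by (intro tendsto_mult_left_zero LIMSEQ_Suc LIMSEQ_power_zero) auto
  qed
  moreover have "(\<lambda>n. iterate (Suc n) s k) \<longlonglongrightarrow> value_fun M U s k"
    using iterate_tendsto_value_fun[OF assms] by (rule LIMSEQ_Suc)
  ultimately show ?thesis
    by (rule LIMSEQ_unique)
qed

lemma action_value_le_value_fun:
  assumes "s \<le> worst M"
  shows "action_value M U (value_fun M U) s k a \<le> value_fun M U s k"
  using action_value_le_bellman[of M U "value_fun M U" s k a] bellman_value_fun[OF assms] by simp

lemma optimal_action_iff:
  assumes "s \<le> worst M"
  shows "optimal_action M U s k a \<longleftrightarrow> action_value M U (value_fun M U) s k a = value_fun M U s k"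
proof -
  obtain b where "value_fun M U s k = action_value M U (value_fun M U) s k b"
    using bellman_attained[of M U "value_fun M U" s k] bellman_value_fun[OF assms] by metis
  then show ?thesis
    using action_value_le_value_fun[OF assms, of k]
    by (auto simp: optimal_action_def is_arg_max_linorder intro: antisym)
qed

lemma optimal_policy_chosen:
  assumes "optimal_policy M U rk a" and "s \<le> worst M"
  shows "action_value M U (value_fun M U) s k (a s k) = value_fun M U s k"
    and "action_value M U (value_fun M U) s k b = value_fun M U s k \<Longrightarrow> rk (a s k) \<le> rk b"
  using assms optimal_action_iff[OF assms(2)]
  by (auto simp: optimal_policy_def is_arg_min_linorder)

end

lemma value_fun_mono:
  assumes "robust_model M U1 B" and "robust_model M U2 B"
    and sub: "\<And>s k. s \<le> worst M \<Longrightarrow> U1 s k \<subseteq> U2 s k" and "s \<le> worst M"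
  shows "value_fun M U2 s k \<le> value_fun M U1 s k"
proof -
  interpret R1: robust_model M U1 B by fact
  interpret R2: robust_model M U2 B by fact
  have "R2.iterate n s k \<le> R1.iterate n s k" if "s \<le> worst M" for n s k
    using that
  proof (induction n arbitrary: s k)
    case (Suc n)
    then show ?case
      using bellman_mono[of M 0 U1 s k U2 "R2.iterate n" "R1.iterate n"]
        R1.discount R1.nonempty R2.prob sub by simp
  qed simp
  then show ?thesis
    using assms(4)
    by (intro LIMSEQ_le[OF R2.iterate_tendsto_value_fun R1.iterate_tendsto_value_fun]) auto
qed

section \<open>Comparison of control limits\<close>

lemma instance_prob_vectors:
  assumes "KL_instance M U \<or> interval_instance M U" and "s \<le> worst M"
  shows "U s k \<subseteq> prob_vectors (worst M)"
  using assms by (auto simp: KL_instance_def interval_instance_def KL_ambiguity_def interval_ambiguity_def)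

text \<open>For intervals this is part of the instance. For KL sets, finite divergence forces
  \<open>p\<close> to vanish wherever the nominal row does.\<close>

lemma instance_deteriorating:
  assumes "KL_instance M U \<or> interval_instance M U" and "s \<le> worst M"
    and "p \<in> U s k" and "s' < s"
  shows "p s' = 0"
  using assms(1)
proof
  assume "interval_instance M U"
  then show ?thesis
    using assms(2-4) by (auto simp: interval_instance_def deteriorating_def)
next
  assume "KL_instance M U"
  then obtain phat \<theta> where "deteriorating (worst M) s (phat s k)"
    and U: "U s k = KL_ambiguity M phat \<theta> s k"
    unfolding KL_instance_def using assms(2) by blast
  then have "phat s k s' = 0"
    using assms(4) by (simp add: deteriorating_def)
  moreover have "p s' \<ge> 0" and "KL_dist (worst M) p (phat s k) \<noteq> \<infinity>"
    using assms(2-4) U by (auto simp: KL_ambiguity_def prob_vectors_def)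
  ultimately show ?thesis
    using assms(2,4) by (auto simp: KL_dist_def less_le dest: spec[of _ s'] split: if_splits)
qed

lemma common_conditions_reward_le:
  assumes "common_conditions M" and "s \<le> worst M"
  shows "reward M s k \<le> reward M 0 0"
proof -
  have "gain M s k \<le> gain M 0 k" "gain M 0 k \<le> gain M 0 0"
    "env_cost M 0 k \<le> env_cost M s k" "env_cost M 0 0 \<le> env_cost M 0 k"
    using assms by (auto simp: common_conditions_def monotone_on_def)
  then show ?thesis
    by (simp add: reward_def)
qed

theorem theorem5:
  fixes M :: model
    and U1 U2 :: ambiguity
    and rk :: "action \<Rightarrow> nat"
    and a1 a2 :: "nat \<Rightarrow> nat \<Rightarrow> action"
    and k1 k2 :: nat
    and \<zeta>1 \<zeta>2 :: "nat \<Rightarrow> nat"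
    and pstar1 :: rows
  assumes "0 < discount M" and "discount M < 1"
    and "KL_instance M U1 \<or> interval_instance M U1"
    and "KL_instance M U2 \<or> interval_instance M U2"
    and "\<And>s k. s \<le> worst M \<Longrightarrow> U1 s k \<subseteq> U2 s k"
    and "common_conditions M"
    and "inj rk"
    and "optimal_policy M U1 rk a1" and "control_limits M a1 k1 \<zeta>1"
    and "optimal_policy M U2 rk a2" and "control_limits M a2 k2 \<zeta>2"
    and "\<And>s k. s \<le> worst M \<Longrightarrow> worst_case M U1 s k (pstar1 s k)"
  shows "(\<forall>k<k1. (\<zeta>1 k > 0 \<longrightarrow> pstar1 (\<zeta>1 k - 1) k (\<zeta>1 k - 1) = 0) \<longrightarrow> \<zeta>1 k \<le> \<zeta>2 k)
    \<and> (\<forall>k\<ge>k1. \<zeta>1 k \<ge> \<zeta>2 k)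
    \<and> k1 \<ge> k2"
proof -
  let ?V1 = "value_fun M U1" and ?V2 = "value_fun M U2" and ?\<beta> = "discount M"
  let ?w1 = "action_value M U1 ?V1" and ?w2 = "action_value M U2 ?V2"
  \<comment> \<open>A worst-case row also witnesses that \<open>U1 s k\<close>, and hence
    \<open>U2 s k\<close>, is nonempty.\<close>
  have pstar: "pstar1 s k \<in> U1 s k" if "s \<le> worst M" for s k
    using assms(12)[OF that] by (simp add: worst_case_def is_arg_min_def)
  interpret R1: robust_model M U1 "reward M 0 0"
    using assms(1,2,6) pstar instance_prob_vectors[OF assms(3)] common_conditions_reward_le
    by unfold_locales blast+
  interpret R2: robust_model M U2 "reward M 0 0"
    using assms(1,2,5,6) pstar instance_prob_vectors[OF assms(4)] common_conditions_reward_le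
    by unfold_locales blast+
  have value_le: "?V2 s k \<le> ?V1 s k" if "s \<le> worst M" for s k
    by (rule value_fun_mono[OF R1.robust_model_axioms R2.robust_model_axioms assms(5) that])
  have w_le: "?w2 s k a \<le> ?w1 s k a" if "s \<le> worst M" for s k a
    using action_value_mono[of M 0 U1 s k U2 ?V2 ?V1 a] value_le
      R1.discount R1.nonempty[OF that] R2.prob[OF that] assms(5)[OF that] by simp
  note le1 = R1.action_value_le_value_fun and le2 = R2.action_value_le_value_fun
  note chosen1 = R1.optimal_policy_chosen[OF assms(8)] and chosen2 = R2.optimal_policy_chosen[OF assms(10)]
  have \<zeta>1: "\<zeta>1 k \<le> worst M" and a1: "s \<le> worst M \<Longrightarrow>
      a1 s k = (if s < \<zeta>1 k then Continue else if k < k1 then Remanufacture else Scrap)" for s k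
    using assms(9) by (auto simp: control_limits_def)
  have \<zeta>2: "\<zeta>2 k \<le> worst M" and a2: "s \<le> worst M \<Longrightarrow>
      a2 s k = (if s < \<zeta>2 k then Continue else if k < k2 then Remanufacture else Scrap)" for s k
    using assms(11) by (auto simp: control_limits_def)
  \<comment> \<open>Both values are squeezed to the salvage value, so the action chosen in the
    second instance is optimal in the first too. Each choice then ranks no higher than the other,
    and injectivity of \<open>rk\<close> identifies them.\<close>
  have scrap: "a2 s k = Scrap" if s: "s \<le> worst M" and "a1 s k = Scrap" for s k
  proof -
    have V1: "?V1 s k = salvage M"
      using chosen1(1)[OF s, of k] that(2) by simp
    then have V2: "?V2 s k = salvage M"
      using value_le[OF s, of k] le2[OF s, of k Scrap] by simp
    have "?w1 s k (a2 s k) = ?V1 s k"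
      using chosen2(1)[OF s, of k] w_le[OF s, of k "a2 s k"] le1[OF s, of k "a2 s k"] V1 V2 by simp
    then have "rk Scrap \<le> rk (a2 s k)"
      using chosen1(2)[OF s, of k "a2 s k"] that(2) by simp
    moreover have "rk (a2 s k) \<le> rk Scrap"
      using V2 by (intro chosen2(2)[OF s]) simp
    ultimately show ?thesis
      using assms(7) by (simp add: inj_eq)
  qed
  have "\<zeta>2 k \<le> \<zeta>1 k" if "k1 \<le> k" for k
    using scrap[of "\<zeta>1 k" k] a1[of "\<zeta>1 k" k] a2[of "\<zeta>1 k" k] \<zeta>1[of k] that
    by (auto split: if_splits)
  \<comment> \<open>At count \<open>k1\<close> the first instance scraps in the worst condition,
    hence so does the second, which rules out \<open>k1 < k2\<close>.\<close>
  moreover have "k2 \<le> k1"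
    using scrap[of "worst M" k1] a1[of "worst M" k1] a2[of "worst M" k1] \<zeta>1[of k1] \<zeta>2[of k1]
    by (auto split: if_splits)
  moreover have "\<zeta>1 k \<le> \<zeta>2 k"
    if "k < k1" and leave: "\<zeta>1 k > 0 \<longrightarrow> pstar1 (\<zeta>1 k - 1) k (\<zeta>1 k - 1) = 0" for k
  proof (cases "\<zeta>1 k = 0")
    case False
    define s where "s = \<zeta>1 k - 1"
    have s: "s \<le> worst M" "s < \<zeta>1 k"
      using False \<zeta>1[of k] by (simp_all add: s_def)
    have a1s: "a1 s k = Continue"
      using a1 s by simp
    \<comment> \<open>\<open>T1\<close> needs no maximum since \<open>k < k1\<close>;
      \<open>T2\<close> keeps both actions because \<open>k < k2\<close> is not known. Neither
      depends on \<open>s\<close>.\<close>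
    define T1 where "T1 = ?w1 s k Remanufacture"
    define T2 where "T2 = max (?w2 s k Remanufacture) (salvage M)"
    have V1: "?V1 s' k = T1" if "\<zeta>1 k \<le> s'" "s' \<le> worst M" for s'
      using chosen1(1)[OF that(2), of k] a1[OF that(2), of k] that(1) \<open>k < k1\<close> by (simp add: T1_def)
    have T21: "T2 \<le> T1"
      using w_le[OF s(1), of k Remanufacture] le1[of "\<zeta>1 k" k Scrap] V1[of "\<zeta>1 k"] \<zeta>1[of k]
      by (simp add: T1_def T2_def)
    have T2: "T2 \<le> ?V2 s' k" if "s' \<le> worst M" for s'
      using le2[OF that, of k Remanufacture] le2[OF that, of k Scrap] by (simp add: T2_def)
    have p: "pstar1 s k \<in> prob_vectors (worst M)"
      using pstar R1.prob s(1) by blast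
    have cont1: "?w1 s k Continue = ?V1 s k" "T1 \<le> ?V1 s k"
      using chosen1(1)[OF s(1), of k] a1s le1[OF s(1), of k Remanufacture] by (simp_all add: T1_def)
    have "?w1 s k Continue \<le> continuation M ?V1 s k (pstar1 s k)"
      using pstar[OF s(1)] R1.prob[OF s(1)] assms(1)
      by (auto intro!: cINF_lower bdd_below_continuation)
    also have "\<dots> \<le> reward M s k + ?\<beta> * T1"
    proof (rule continuation_le)
      fix s' assume s': "s' \<le> worst M" "pstar1 s k s' \<noteq> 0"
      \<comment> \<open>Irreversibility excludes lower conditions and the assumption excludes
        \<open>s\<close> itself, so all mass lies at or beyond \<open>\<zeta>1 k\<close>.\<close>
      then have "s' \<noteq> s" "\<not> s' < s"
        using leave False instance_deteriorating[OF assms(3) s(1) pstar[OF s(1)]] by (auto simp: s_def)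
      then show "?V1 s' k \<le> T1"
        using V1 s' by (simp add: s_def)
    qed (use assms(1) p in simp_all)
    finally have up: "?V1 s k \<le> reward M s k + ?\<beta> * T1"
      using cont1 by simp
    have low: "reward M s k + ?\<beta> * T2 \<le> ?w2 s k Continue"
      using R2.nonempty[OF s(1)] R2.prob[OF s(1)] assms(1) T2
      by (auto intro!: cINF_greatest continuation_ge)
    have mult: "?\<beta> * (T1 - T2) \<le> T1 - T2" "?\<beta> * (T1 - T2) = T1 - T2 \<Longrightarrow> T1 = T2"
      using T21 assms(2) mult_right_mono[of ?\<beta> 1 "T1 - T2"] by simp_all
    have "a2 s k = Continue"
    proof (rule ccontr)
      assume other: "a2 s k \<noteq> Continue"
      then have V2: "?w2 s k (a2 s k) \<le> T2"
        by (cases "a2 s k") (simp_all add: T2_def)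
      then have V2': "?V2 s k = T2"
        using chosen2(1)[OF s(1), of k] T2[OF s(1)] by simp
      have le: "?w2 s k Continue \<le> T2"
        using le2[OF s(1), of k Continue] V2' by simp
      \<comment> \<open>\<open>T1 - \<beta> T1 \<le> r \<le> T2 - \<beta> T2\<close>, with
        \<open>r\<close> the reward at \<open>s\<close>, while \<open>T2 \<le> T1\<close> and
        \<open>\<beta> < 1\<close>.\<close>
      have "T1 = T2"
        using mult up low le cont1(2) by (simp add: algebra_simps)
      \<comment> \<open>With \<open>T\<close> the common value, \<open>r + \<beta> T \<le> ?w2 s k
        Continue \<le> T \<le> ?V1 s k \<le> r + \<beta> T\<close>, so equality holds throughout.
        \<open>Continue\<close> and \<open>a2 s k\<close> are thus tied in both instances, and the
        common ranking cannot favour different ones.\<close>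
      then have "?w2 s k Continue = ?V2 s k" and V12: "?V1 s k = ?V2 s k"
        using up low le cont1(2) V2' value_le[OF s(1), of k] w_le[OF s(1), of k Continue] by simp_all
      then have "rk (a2 s k) \<le> rk Continue"
        by (intro chosen2(2)[OF s(1)])
      moreover have "?w1 s k (a2 s k) = ?V1 s k"
        using chosen2(1)[OF s(1), of k] w_le[OF s(1), of k "a2 s k"] le1[OF s(1), of k "a2 s k"] V12
        by simp
      then have "rk Continue \<le> rk (a2 s k)"
        using chosen1(2)[OF s(1), of k "a2 s k"] a1s by simp
      ultimately show False
        using other assms(7) by (simp add: inj_eq)
    qed
    then have "s < \<zeta>2 k"
      using a2[OF s(1), of k] by (auto split: if_splits)
    then show ?thesis
      by (simp add: s_def)
  qed simp
  ultimately show ?thesis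
    by blast
qed

end
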